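(* Let $f\colon \mathbb{S}^{n\times n}\to\mathbb{R}$ be twice continuously differentiable and concave, and let $p>\frac{d+1}{d+3}\,n$. If $Y\in\mathrm{St}(d,p)^m$ is a second-order critical point of $(\mathrm{RP}_p)$, then $X=YY^\top$ is a KKT point of $(\mathrm{P})$. If furthermore $f$ is linear, then all second-order critical points of $(\mathrm{RP}_p)$ are global optimizers of $(\mathrm{RP}_p)$.
   Context: Integers satisfy $m\ge 1$, $1\le d\le p\le n=md$. $\mathbb{S}^{k\times k}$ is the space of real symmetric $k\times k$ matrices. Matrices $M\in\mathbb{R}^{n\times n}$ are viewed as $m\times m$ block matrices with blocks $M_{ij}\in\mathbb{R}^{d\times d}$; $Y\in\mathbb{R}^{n\times p}$ is viewed as a stack of slices $Y_1,\dots,Y_m\in\mathbb{R}^{d\times p}$. Inner product: $\langle A,B\rangle=\operatorname{trace}(A^\top B)$. $\nabla f(X)\in\mathbb{S}^{n\times n}$ and $\nabla^2 f(X)$ are the Euclidean gradient and Hessian operator of $f$ on $\mathbb{S}^{n\times n}$. Define $\mathrm{St}(d,p)^m=\{Y\in\mathbb{R}^{n\times p}: Y_iY_i^\top=I_d,\ i=1,\dots,m\}$ and $\mathcal{C}=\{X\in\mathbb{S}^{n\times n}: X\succeq 0,\ X_{ii}=I_d,\ i=1,\dots,m\}$. Problem $(\mathrm{P})$: minimize $f(X)$ over $X\in\mathcal{C}$. Problem $(\mathrm{RP}_p)$: minimize $g(Y)=f(YY^\top)$ over $Y\in\mathrm{St}(d,p)^m$. $\operatorname{symblockdiag}(M)$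 is the matrix with diagonal blocks $(M_{ii}+M_{ii}^\top)/2$ and all other blocks zero. The tangent space is $\mathrm{T}_Y\mathrm{St}(d,p)^m=\{\dot Y\in\mathbb{R}^{n\times p}:\operatorname{symblockdiag}(\dot YY^\top+Y\dot Y^\top)=0\}$. With $X=YY^\top$, $Y\in\mathrm{St}(d,p)^m$ is a critical point of $(\mathrm{RP}_p)$ if the Riemannian gradient of $g$ vanishes, i.e. $(\nabla f(X)-\operatorname{symblockdiag}(\nabla f(X)X))Y=0$. It is a second-order critical point if moreover the Riemannian Hessian is positive semidefinite, i.e. $\langle\dot Y,\nabla^2 g(Y)[\dot Y]-\operatorname{symblockdiag}(\nabla g(Y)Y^\top)\dot Y\rangle\ge 0$ for all $\dot Y\in\mathrm{T}_Y\mathrm{St}(d,p)^m$, where $\nabla g(Y)=2\nabla f(X)Y$ and $\nabla^2g(Y)[\dot Y]=2(\nabla^2f(X)[\dot X]Y+\nabla f(X)\dot Y)$ with $\dot X=\dot YY^\top+Y\dot Y^\top$. $X\in\mathcal{C}$ is a KKT point of $(\mathrm{P})$ if there exist $\hat S\in\mathbb{S}^{n\times n}$ and a symmetric block-diagonal (with $d\times d$ blocks) $\hat\Lambda\in\mathbb{S}^{n\times n}$ such that $\hat SX=0$, $\hat S=\nabla f(X)+\hat\Lambda$ and $\hat S\succeq 0$. *)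

theory Defs
  imports "HOL-Analysis.Analysis"
begin

text \<open>
  Conventions. With index types 'm, 'd, 'p we have m = CARD('m), d = CARD('d), p = CARD('p)
  and n = m * d. Rows and columns of an n x n matrix are indexed by pairs (i, a) of type
  'm \<times> 'd, where i is the index of the block and a is the position inside that block.
  The inner product of matrices is the library one; by the lemma inner_matrix_eq_trace it
  is trace (transpose A ** B).
\<close>

type_synonym ('m, 'd) bmat = "real ^ ('m \<times> 'd) ^ ('m \<times> 'd)"

lemma inner_matrix_eq_trace:
  fixes A B :: "real ^ 'c ^ 'r"
  shows "A \<bullet> B = trace (transpose A ** B)"
  unfolding inner_vec_def trace_def matrix_matrix_mult_def transpose_def
  by (simp, rule sum.swap)

definition block :: "('m::finite, 'd::finite) bmat \<Rightarrow> 'm \<Rightarrow> 'm \<Rightarrow> real ^ 'd ^ 'd" where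
  "block M i j = (\<chi> a b. M $ (i, a) $ (j, b))"

definition slice :: "real ^ 'p ^ ('m::finite \<times> 'd::finite) \<Rightarrow> 'm \<Rightarrow> real ^ 'p ^ 'd" where
  "slice Y i = (\<chi> a. Y $ (i, a))"

definition symblockdiag :: "('m::finite, 'd::finite) bmat \<Rightarrow> ('m, 'd) bmat" where
  "symblockdiag M = (\<chi> r c. if fst r = fst c
     then ((1/2) *\<^sub>R (block M (fst r) (fst r) + transpose (block M (fst r) (fst r)))) $ snd r $ snd c
     else 0)"

definition block_diagonal :: "('m::finite, 'd::finite) bmat \<Rightarrow> bool" where
  "block_diagonal M \<longleftrightarrow> (\<forall>i j. i \<noteq> j \<longrightarrow> block M i j = 0)"

definition Sym :: "(real ^ 'n ^ 'n) set" where
  "Sym = {X. transpose X = X}"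

definition psd :: "real ^ 'n ^ 'n \<Rightarrow> bool" where
  "psd X \<longleftrightarrow> X \<in> Sym \<and> (\<forall>v. 0 \<le> v \<bullet> (X *v v))"

definition St :: "(real ^ 'p ^ ('m::finite \<times> 'd::finite)) set" where
  "St = {Y. \<forall>i. slice Y i ** transpose (slice Y i) = mat 1}"

definition feasible_set :: "('m::finite, 'd::finite) bmat set" where
  "feasible_set = {X. X \<in> Sym \<and> psd X \<and> (\<forall>i. block X i i = mat 1)}"

text \<open>
  A function on the space of symmetric matrices is represented by a total function on all
  square matrices of which only the values on Sym matter: all derivatives are taken within
  Sym, and the gradient is the symmetric matrix representing the derivative. As Sym is in general a
  proper subspace, a derivative within Sym is determined only in symmetric directions
  (lemma has_derivative_within_Sym_unique), and the Hessian is only used in such directions.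
\<close>

definition sym_grad :: "(real ^ 'n ^ 'n \<Rightarrow> real) \<Rightarrow> real ^ 'n ^ 'n \<Rightarrow> real ^ 'n ^ 'n" where
  "sym_grad f X = (THE G. G \<in> Sym \<and> (f has_derivative (\<lambda>H. G \<bullet> H)) (at X within Sym))"

definition sym_hess ::
  "(real ^ 'n ^ 'n \<Rightarrow> real) \<Rightarrow> real ^ 'n ^ 'n \<Rightarrow> real ^ 'n ^ 'n \<Rightarrow> real ^ 'n ^ 'n" where
  "sym_hess f X H = frechet_derivative (sym_grad f) (at X within Sym) H"

text \<open>
  In finite dimension, continuity of the Hessian in each fixed direction is the same as
  continuity in the operator norm.
\<close>

definition C2_on_Sym :: "(real ^ 'n ^ 'n \<Rightarrow> real) \<Rightarrow> bool" where
  "C2_on_Sym f \<longleftrightarrow> f differentiable_on Sym \<and> sym_grad f differentiable_on Sym \<and>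
     (\<forall>H\<in>Sym. continuous_on Sym (\<lambda>X. sym_hess f X H))"

definition linear_on_Sym :: "(real ^ 'n ^ 'n \<Rightarrow> real) \<Rightarrow> bool" where
  "linear_on_Sym f \<longleftrightarrow>
     (\<forall>A\<in>Sym. \<forall>B\<in>Sym. f (A + B) = f A + f B) \<and> (\<forall>c. \<forall>A\<in>Sym. f (c *\<^sub>R A) = c * f A)"

lemma subspace_Sym: "subspace (Sym :: (real ^ 'n ^ 'n) set)"
  by (auto simp: subspace_def Sym_def transpose_def vec_eq_iff)

lemma has_derivative_within_Sym_unique:
  fixes f :: "real ^ 'n ^ 'n \<Rightarrow> 'b::real_normed_vector"
  assumes "(f has_derivative F) (at X within Sym)" "(f has_derivative G) (at X within Sym)"
    and "X \<in> Sym" "H \<in> Sym"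
  shows "F H = G H"
proof -
  have line: "((\<lambda>t::real. X + t *\<^sub>R H) has_derivative (\<lambda>t. t *\<^sub>R H)) (at 0)"
    by (auto intro!: derivative_eq_intros)
  have sub: "range (\<lambda>t::real. X + t *\<^sub>R H) \<subseteq> Sym"
    using subspace_Sym assms(3,4) by (auto intro: subspace_add subspace_scale)
  have comp: "((\<lambda>t. f (X + t *\<^sub>R H)) has_derivative (\<lambda>t. K (t *\<^sub>R H))) (at 0)"
    if "(f has_derivative K) (at X within Sym)" for K
  proof -
    have "(f has_derivative K) (at (X + 0 *\<^sub>R H) within range (\<lambda>t::real. X + t *\<^sub>R H))"
      using has_derivative_subset[OF that sub] by simp
    from has_derivative_in_compose[OF line this] show ?thesis .
  qed
  have "(\<lambda>t. F (t *\<^sub>R H)) = (\<lambda>t. G (t *\<^sub>R H))"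
    using has_derivative_unique[OF comp[OF assms(1)] comp[OF assms(2)]] .
  then show ?thesis by (metis scaleR_one)
qed

lemma sym_grad_eq:
  assumes "G \<in> Sym" "X \<in> Sym" "(f has_derivative (\<lambda>H. G \<bullet> H)) (at X within Sym)"
  shows "sym_grad f X = G"
  unfolding sym_grad_def
proof (rule the_equality)
  fix G' assume G': "G' \<in> Sym \<and> (f has_derivative (\<lambda>H. G' \<bullet> H)) (at X within Sym)"
  have D: "G' - G \<in> Sym" using G' assms(1) subspace_Sym by (auto intro: subspace_diff)
  have "G' \<bullet> (G' - G) = G \<bullet> (G' - G)"
    using has_derivative_within_Sym_unique[OF conjunct2[OF G'] assms(3,2) D] .
  then have "(G' - G) \<bullet> (G' - G) = 0" by (simp add: inner_diff_left)
  then show "G' = G" by simp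
qed (use assms in auto)

lemma sym_grad_has_derivative:
  fixes f :: "real ^ 'n ^ 'n \<Rightarrow> real"
  assumes "X \<in> Sym" "f differentiable (at X within Sym)"
  shows "sym_grad f X \<in> Sym"
    and "(f has_derivative (\<lambda>H. sym_grad f X \<bullet> H)) (at X within Sym)"
proof -
  obtain F where F: "(f has_derivative F) (at X within Sym)"
    using assms(2) by (auto simp: differentiable_def)
  interpret bounded_linear F using F by (rule has_derivative_bounded_linear)
  define G0 where "G0 = (\<Sum>b\<in>Basis. F b *\<^sub>R b)"
  have G0: "F H = G0 \<bullet> H" for H
  proof -
    have "F H = F (\<Sum>b\<in>Basis. (H \<bullet> b) *\<^sub>R b)" by (simp add: euclidean_representation)
    also have "\<dots> = (\<Sum>b\<in>Basis. (H \<bullet> b) * F b)" by (simp add: sum scaleR)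
    also have "\<dots> = G0 \<bullet> H"
      unfolding G0_def inner_sum_left inner_scaleR_left
      by (simp add: mult.commute inner_commute)
    finally show ?thesis .
  qed
  define G where "G = (1/2) *\<^sub>R (G0 + transpose G0)"
  have GS: "G \<in> Sym" by (simp add: G_def Sym_def transpose_def vec_eq_iff)
  have tr: "transpose G0 \<bullet> H = G0 \<bullet> transpose H" for H
    unfolding inner_vec_def transpose_def by (simp, rule sum.swap)
  have eq: "F H = G \<bullet> H" if "H \<in> Sym" for H
    using that by (simp add: G_def inner_add_left tr G0 Sym_def)
  have der: "(f has_derivative (\<lambda>H. G \<bullet> H)) (at X within Sym)"
    unfolding has_derivative_within
  proof
    show "bounded_linear ((\<bullet>) G)" by (rule bounded_linear_inner_right)
    have "((\<lambda>y. (1 / norm (y - X)) *\<^sub>R (f y - (f X + F (y - X)))) \<longlongrightarrow> 0) (at X within Sym)"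
      using F by (simp add: has_derivative_within)
    moreover have "\<forall>\<^sub>F y in at X within Sym.
        (1 / norm (y - X)) *\<^sub>R (f y - (f X + F (y - X))) =
        (1 / norm (y - X)) *\<^sub>R (f y - (f X + G \<bullet> (y - X)))"
      using assms(1) subspace_Sym eq
      by (auto simp: eventually_at intro!: exI[of _ 1] subspace_diff)
    ultimately show "((\<lambda>y. (1 / norm (y - X)) *\<^sub>R (f y - (f X + G \<bullet> (y - X)))) \<longlongrightarrow> 0)
        (at X within Sym)"
      by (rule Lim_transform_eventually)
  qed
  have "sym_grad f X = G" by (rule sym_grad_eq[OF GS assms(1) der])
  with GS der show "sym_grad f X \<in> Sym"
    "(f has_derivative (\<lambda>H. sym_grad f X \<bullet> H)) (at X within Sym)" by auto
qed

lemma sym_hess_eq: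
  assumes "(sym_grad f has_derivative K) (at X within Sym)" "X \<in> Sym" "H \<in> Sym"
  shows "sym_hess f X H = K H"
proof -
  have "(sym_grad f has_derivative frechet_derivative (sym_grad f) (at X within Sym))
      (at X within Sym)"
    using assms(1) frechet_derivative_works differentiable_def by blast
  from has_derivative_within_Sym_unique[OF this assms(1-3)]
  show ?thesis by (simp add: sym_hess_def)
qed

definition tangent_space ::
  "real ^ 'p ^ ('m::finite \<times> 'd::finite) \<Rightarrow> (real ^ 'p ^ ('m \<times> 'd)) set" where
  "tangent_space Y = {Z. symblockdiag (Z ** transpose Y + Y ** transpose Z) = 0}"

definition cost ::
  "(('m::finite, 'd::finite) bmat \<Rightarrow> real) \<Rightarrow> real ^ 'p ^ ('m \<times> 'd) \<Rightarrow> real" where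
  "cost f Y = f (Y ** transpose Y)"

definition cost_grad ::
  "(('m::finite, 'd::finite) bmat \<Rightarrow> real) \<Rightarrow> real ^ 'p ^ ('m \<times> 'd) \<Rightarrow> real ^ 'p ^ ('m \<times> 'd)" where
  "cost_grad f Y = 2 *\<^sub>R (sym_grad f (Y ** transpose Y) ** Y)"

definition cost_hess ::
  "(('m::finite, 'd::finite) bmat \<Rightarrow> real) \<Rightarrow> real ^ 'p ^ ('m \<times> 'd) \<Rightarrow> real ^ 'p ^ ('m \<times> 'd)
    \<Rightarrow> real ^ 'p ^ ('m \<times> 'd)" where
  "cost_hess f Y Z =
     2 *\<^sub>R (sym_hess f (Y ** transpose Y) (Z ** transpose Y + Y ** transpose Z) ** Y
          + sym_grad f (Y ** transpose Y) ** Z)"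

definition critical_point ::
  "(('m::finite, 'd::finite) bmat \<Rightarrow> real) \<Rightarrow> real ^ 'p ^ ('m \<times> 'd) \<Rightarrow> bool" where
  "critical_point f Y \<longleftrightarrow> Y \<in> St \<and>
     (let X = Y ** transpose Y
      in (sym_grad f X - symblockdiag (sym_grad f X ** X)) ** Y = 0)"

definition second_order_critical_point ::
  "(('m::finite, 'd::finite) bmat \<Rightarrow> real) \<Rightarrow> real ^ 'p ^ ('m \<times> 'd) \<Rightarrow> bool" where
  "second_order_critical_point f Y \<longleftrightarrow> critical_point f Y \<and>
     (\<forall>Z\<in>tangent_space Y.
        0 \<le> Z \<bullet> (cost_hess f Y Z - symblockdiag (cost_grad f Y ** transpose Y) ** Z))"

definition KKT_point :: "(('m::finite, 'd::finite) bmat \<Rightarrow> real) \<Rightarrow> ('m, 'd) bmat \<Rightarrow> bool" where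
  "KKT_point f X \<longleftrightarrow> X \<in> feasible_set \<and>
     (\<exists>S \<Lambda>. S \<in> Sym \<and> \<Lambda> \<in> Sym \<and> block_diagonal \<Lambda> \<and>
        S ** X = 0 \<and> S = sym_grad f X + \<Lambda> \<and> psd S)"

definition global_optimizer_RP ::
  "(('m::finite, 'd::finite) bmat \<Rightarrow> real) \<Rightarrow> real ^ 'p ^ ('m \<times> 'd) \<Rightarrow> bool" where
  "global_optimizer_RP f Y \<longleftrightarrow> Y \<in> St \<and> (\<forall>Z\<in>(St :: (real ^ 'p ^ ('m \<times> 'd)) set). cost f Y \<le> cost f Z)"

end

theory Submission
  imports Defs
begin

text \<open>
  Put \<open>S = \<nabla>f X - symblockdiag (\<nabla>f X X)\<close>, so that criticality says \<open>S Y = 0\<close>. Since the Hessian of a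
  concave function is negative semidefinite, the second-order condition gives \<open>\<langle>Z, S Z\<rangle> \<ge> 0\<close> for
  tangent \<open>Z\<close>. If \<open>Z = x v\<^sup>T + Y A\<close> is tangent with \<open>v \<noteq> 0\<close>, then \<open>\<langle>Z, S Z\<rangle> = \<bar>v\<bar>\<^sup>2 x\<^sup>T S x\<close>, so it
  suffices to find such \<open>v\<close> and \<open>A\<close> for every \<open>x\<close>. If \<open>Y\<close> has a kernel, take \<open>v\<close> in it and \<open>A = 0\<close>.
  Otherwise, by duality, \<open>A\<close> exists as soon as \<open>v\<close> is orthogonal to \<open>Y\<^sup>T \<Lambda> x\<close> for all \<open>\<Lambda>\<close> in the space
  \<open>N\<close> of symmetric block-diagonal \<open>\<Lambda>\<close> with \<open>Y\<^sup>T \<Lambda> Y = 0\<close>, and a nonzero such \<open>v\<close> exists if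
  \<open>dim N < p\<close>. Adding the blocks one at a time shows \<open>2 dim N \<le> (d + 1) (n - p)\<close>, which is less
  than \<open>2 p\<close> exactly when \<open>p > (d + 1) / (d + 3) n\<close>.

  For linear \<open>f\<close>, the KKT certificate \<open>S \<succeq> 0\<close> yields
  \<open>f (Z Z\<^sup>T) - f X = \<langle>S, Z Z\<^sup>T\<rangle> \<ge> 0\<close> for every feasible \<open>Z\<close>.
\<close>

section \<open>Dimension counts for subspaces and symmetric matrices\<close>

text \<open>Rank-nullity on a subspace: \<open>f\<close> is injective on the orthogonal complement
  \<open>C\<close> of its kernel inside \<open>S\<close>, so \<open>dim C\<close> is at most the
  dimension of the image.\<close>

lemma dim_le_dim_kernel_image:
  fixes f :: "'a::euclidean_space \<Rightarrow> 'b::euclidean_space"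
  assumes f: "linear f" and S: "subspace S"
  shows "dim S \<le> dim {x \<in> S. f x = 0} + dim (f ` S)"
proof -
  define K where "K = {x \<in> S. f x = 0}"
  define C where "C = {y \<in> S. \<forall>x\<in>K. orthogonal x y}"
  have K: "subspace K"
    unfolding K_def using S f by (auto simp: subspace_def linear_add linear_scale linear_0)
  have C: "subspace C"
    unfolding C_def using S by (auto simp: subspace_def orthogonal_clauses)
  have inj: "inj_on f (span C)"
  proof (rule inj_onI)
    fix x y assume xy: "x \<in> span C" "y \<in> span C" "f x = f y"
    then have "x - y \<in> C" using C by (simp add: span_eq_iff[THEN iffD2] subspace_diff)
    moreover from this have "x - y \<in> K"
      using xy f by (auto simp: K_def C_def linear_diff)
    ultimately have "orthogonal (x - y) (x - y)" by (auto simp: C_def)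
    then show "x = y" by (simp add: orthogonal_def)
  qed
  have "dim C + dim K = dim S"
    unfolding C_def by (rule dim_subspace_orthogonal_to_vectors[OF K S]) (auto simp: K_def)
  moreover have "dim C = dim (f ` C)" using dim_image_eq[OF f inj] by simp
  moreover have "dim (f ` C) \<le> dim (f ` S)"
    by (intro dim_subset image_mono) (auto simp: C_def)
  ultimately show ?thesis by (simp add: K_def)
qed

definition outer :: "real ^ 'r \<Rightarrow> real ^ 'c \<Rightarrow> real ^ 'c ^ 'r" where
  "outer x v = (\<chi> i j. x $ i * v $ j)"

lemma outer_mult_vec: "outer x v *v z = (v \<bullet> z) *\<^sub>R x"
  by (simp add: outer_def matrix_vector_mult_def vec_eq_iff inner_vec_def sum_distrib_right
      sum_distrib_left ac_simps)

lemma outer_mult_transpose: "outer x v ** transpose A = outer x (A *v v)"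
  by (simp add: outer_def matrix_vector_mult_def matrix_matrix_mult_def transpose_def vec_eq_iff
      sum_distrib_left ac_simps)

lemma matrix_mult_outer: "A ** outer x v = outer (A *v x) v"
  by (simp add: outer_def matrix_vector_mult_def matrix_matrix_mult_def vec_eq_iff
      sum_distrib_right mult.assoc)

lemma transpose_outer: "transpose (outer x v) = outer v x"
  by (simp add: outer_def transpose_def vec_eq_iff)

lemma inner_outer: "M \<bullet> outer x v = x \<bullet> (M *v v)"
  by (simp add: outer_def inner_vec_def matrix_vector_mult_def sum_distrib_left ac_simps)

lemma outer_zero [simp]: "outer x 0 = 0" "outer 0 v = 0"
  by (simp_all add: outer_def vec_eq_iff)

text \<open>By symmetry of \<open>g\<close>, a new element \<open>a\<close> contributes only the
  values \<open>g a c\<close> with \<open>c\<close> in \<open>insert a B\<close>, so the count is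
  bounded by a triangular number. The factor 2 avoids division in the naturals.\<close>

lemma card_image2_symmetric:
  assumes "finite B" and "\<And>b c. g b c = g c b"
  shows "2 * card {g b c |b c. b \<in> B \<and> c \<in> B} \<le> card B * (card B + 1)"
  using assms(1)
proof (induction B rule: finite_induct)
  case (insert a B)
  have fin: "finite {g b c |b c. b \<in> B \<and> c \<in> B}"
    using finite_image_set2[of "\<lambda>b. b \<in> B" "\<lambda>c. c \<in> B" g] insert.hyps by simp
  have "{g b c |b c. b \<in> insert a B \<and> c \<in> insert a B}
      \<subseteq> {g b c |b c. b \<in> B \<and> c \<in> B} \<union> g a ` insert a B"
    using assms(2) by blast
  then have "card {g b c |b c. b \<in> insert a B \<and> c \<in> insert a B}
      \<le> card ({g b c |b c. b \<in> B \<and> c \<in> B} \<union> g a ` insert a B)"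
    by (rule card_mono[rotated]) (use fin insert.hyps in auto)
  also have "\<dots> \<le> card {g b c |b c. b \<in> B \<and> c \<in> B} + card (g a ` insert a B)"
    by (rule card_Un_le)
  also have "\<dots> \<le> card {g b c |b c. b \<in> B \<and> c \<in> B} + card (insert a B)"
    using card_image_le[of "insert a B" "g a"] insert.hyps by simp
  finally show ?case using insert by (simp add: algebra_simps)
qed simp

lemma Sym_inner_swap:
  assumes "M \<in> Sym"
  shows "x \<bullet> (M *v y) = (M *v x) \<bullet> y"
proof -
  have "transpose M = M" using assms by (simp add: Sym_def)
  then show ?thesis by (metis dot_lmul_matrix vector_transpose_matrix)
qed

lemma orthonormal_expansion:
  assumes "pairwise orthogonal B" "\<And>b. b \<in> B \<Longrightarrow> norm b = 1" "finite B" "x \<in> span B"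
  shows "x = (\<Sum>b\<in>B. (b \<bullet> x) *\<^sub>R b)"
proof -
  obtain c where c: "x = (\<Sum>b\<in>B. c b *\<^sub>R b)"
    using assms(3,4) span_finite by blast
  have "b \<bullet> x = c b" if "b \<in> B" for b
  proof -
    have "b \<bullet> x = (\<Sum>e\<in>B. c e * (b \<bullet> e))" by (simp add: c inner_sum_right)
    also have "\<dots> = (\<Sum>e\<in>B. if e = b then c b else 0)"
      using assms(1,2) that
      by (intro sum.cong) (auto simp: pairwise_def orthogonal_def norm_eq_1)
    finally show ?thesis using assms(3) that by simp
  qed
  then show ?thesis using c by simp
qed

text \<open>For an orthonormal basis \<open>B\<close> of \<open>U\<close>, the symmetrised outer
  products \<open>g b c\<close> span these matrices, and unordered pairs from \<open>B\<close> index
  them.\<close>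

lemma dim_Sym_range_subset:
  fixes U :: "(real ^ 'd) set"
  assumes U: "subspace U"
  shows "2 * dim {M \<in> Sym. \<forall>z. M *v z \<in> U} \<le> dim U * (dim U + 1)"
proof -
  obtain B where B: "pairwise orthogonal B" "\<And>x. x \<in> B \<Longrightarrow> norm x = 1"
      "independent B" "card B = dim U" "span B = U"
    using orthonormal_basis_subspace[OF U] by metis
  have fin: "finite B" using B(3) by (rule independent_imp_finite)
  define g where "g = (\<lambda>b c :: real ^ 'd. outer b c + outer c b)"
  define T where "T = {g b c |b c. b \<in> B \<and> c \<in> B}"
  have finT: "finite T"
    unfolding T_def using finite_image_set2[of "\<lambda>b. b \<in> B" "\<lambda>c. c \<in> B" g] fin by simp
  have "{M \<in> Sym. \<forall>z. M *v z \<in> U} \<subseteq> span T"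
  proof safe
    fix M :: "real ^ 'd ^ 'd"
    assume M: "M \<in> Sym" "\<forall>z. M *v z \<in> U"
    have ex: "M *v z = (\<Sum>b\<in>B. (b \<bullet> (M *v z)) *\<^sub>R b)" for z
      using orthonormal_expansion[OF B(1,2) fin, of "M *v z"] M(2) B(5) by auto
    \<comment> \<open>Symmetry moves \<open>M\<close> onto \<open>b\<close>, so the range condition
      also controls the second factor and only outer products of basis vectors occur.\<close>
    have bM: "b \<bullet> (M *v z) = (\<Sum>c\<in>B. (c \<bullet> (M *v b)) * (c \<bullet> z))" for b z
    proof -
      have "b \<bullet> (M *v z) = (M *v b) \<bullet> z" by (rule Sym_inner_swap[OF M(1)])
      also have "\<dots> = (\<Sum>c\<in>B. (c \<bullet> (M *v b)) *\<^sub>R c) \<bullet> z" using ex[of b] by simp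
      finally show ?thesis by (simp add: inner_sum_left)
    qed
    define h where "h = (\<Sum>b\<in>B. \<Sum>c\<in>B. (c \<bullet> (M *v b)) *\<^sub>R outer b c)"
    have Mh: "M = h"
    proof -
      have "M *v z = h *v z" for z
      proof -
        have "M *v z = (\<Sum>b\<in>B. (\<Sum>c\<in>B. (c \<bullet> (M *v b)) * (c \<bullet> z)) *\<^sub>R b)"
          by (subst ex[of z]) (intro sum.cong refl arg_cong[where f = "\<lambda>t. t *\<^sub>R _"] bM)
        also have "\<dots> = h *v z"
        proof -
          interpret lin: linear "\<lambda>H :: real ^ 'd ^ 'd. H *v z"
            by (rule linearI) (simp_all add: matrix_vector_mult_add_rdistrib scaleR_matrix_vector_assoc)
          show ?thesis
            by (simp add: h_def lin.sum lin.scale outer_mult_vec scaleR_sum_left)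
        qed
        finally show ?thesis .
      qed
      then show ?thesis by (simp add: matrix_eq)
    qed
    have swap: "b \<bullet> (M *v c) = c \<bullet> (M *v b)" for b c
      using Sym_inner_swap[OF M(1), of b c] by (simp add: inner_commute)
    \<comment> \<open>Averaging the two forms of \<open>h\<close> replaces each
      \<open>outer b c\<close> by its symmetrisation.\<close>
    have h_swap: "h = (\<Sum>b\<in>B. \<Sum>c\<in>B. (c \<bullet> (M *v b)) *\<^sub>R outer c b)"
      unfolding h_def
      by (subst sum.swap) (simp only: swap)
    have "2 *\<^sub>R M = h + h" unfolding scaleR_2 by (simp only: Mh[symmetric])
    also have "\<dots> = (\<Sum>b\<in>B. \<Sum>c\<in>B. (c \<bullet> (M *v b)) *\<^sub>R g b c)"
      by (subst (2) h_swap, subst h_def) (simp add: g_def scaleR_add_right sum.distrib)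
    also have "\<dots> \<in> span T"
      by (intro span_sum span_scale span_base) (auto simp: T_def)
    finally show "M \<in> span T" using span_scale[of "2 *\<^sub>R M" T "1/2"] by simp
  qed
  then have "dim {M \<in> Sym. \<forall>z. M *v z \<in> U} \<le> card T" using finT by (rule dim_le_card)
  also have "2 * card T \<le> dim U * (dim U + 1)"
    unfolding T_def B(4)[symmetric]
    by (rule card_image2_symmetric[OF fin]) (simp add: g_def add.commute)
  finally show ?thesis by simp
qed

section \<open>Dimension of the space of kernel multipliers\<close>

text \<open>The family \<open>L\<close> lists the diagonal blocks of \<open>\<Lambda>\<close>, and \<open>y i\<close> are the slices of \<open>Y\<close>.\<close>

definition kernel_multipliers ::
  "('m::finite \<Rightarrow> real ^ 'p ^ 'd::finite) \<Rightarrow> 'm set \<Rightarrow> (real ^ 'd ^ 'd ^ 'm) set" where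
  "kernel_multipliers y I = {L. (\<forall>i. L $ i \<in> Sym) \<and> (\<forall>i. i \<notin> I \<longrightarrow> L $ i = 0) \<and>
     (\<Sum>i\<in>UNIV. transpose (y i) ** L $ i ** y i) = 0}"

lemma Sym_zero: "0 \<in> Sym"
  by (rule subspace_0[OF subspace_Sym])

lemma transpose_add: "transpose (A + B) = transpose A + transpose B"
  for A B :: "real ^ 'n ^ 'm"
  by (simp add: transpose_def vec_eq_iff)

lemma sum_matrix_vector_mult: "(\<Sum>i\<in>I. A i) *v z = (\<Sum>i\<in>I. A i *v z)"
  for A :: "'i \<Rightarrow> real ^ 'c ^ 'r"
  by (induction I rule: infinite_finite_induct) (simp_all add: matrix_vector_mult_add_rdistrib)

lemma matrix_mult_add_rdistrib: "(A + B) ** C = A ** C + B ** C"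
  for A B :: "real ^ 'n ^ 'm"
  by (simp add: matrix_matrix_mult_def vec_eq_iff sum.distrib distrib_right)

lemma matrix_mult_diff_rdistrib: "(A - B) ** C = A ** C - B ** C"
  for A B :: "real ^ 'n ^ 'm"
  by (simp add: matrix_matrix_mult_def vec_eq_iff sum_subtractf left_diff_distrib)

lemma matrix_mult_scaleR_left: "(c *\<^sub>R A) ** B = c *\<^sub>R (A ** B)"
  for A :: "real ^ 'n ^ 'm"
  by (simp add: matrix_matrix_mult_def vec_eq_iff sum_distrib_left mult.assoc)

lemma matrix_mult_scaleR_right: "A ** (c *\<^sub>R B) = c *\<^sub>R (A ** B)"
  for A :: "real ^ 'n ^ 'm"
  by (simp add: matrix_matrix_mult_def vec_eq_iff sum_distrib_left ac_simps)

lemma subspace_kernel_multipliers: "subspace (kernel_multipliers y I)"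
  unfolding kernel_multipliers_def
  by (rule subspaceI)
    (auto simp: Sym_zero subspace_add[OF subspace_Sym] subspace_scale[OF subspace_Sym]
      matrix_add_ldistrib matrix_mult_add_rdistrib sum.distrib matrix_mult_scaleR_left
      matrix_mult_scaleR_right scaleR_sum_right[symmetric])

text \<open>Let k be the dimension of the overlap of the row space of the new slice with the old
  span. The new slice raises the span by d - k and the multipliers by at most k(k+1)/2, which is at
  most k(d+1)/2. Hence the weighted sum on the left grows by at most (d+1)d per block.\<close>

lemma dim_kernel_multipliers:
  fixes y :: "'m::finite \<Rightarrow> real ^ 'p ^ 'd::finite"
  assumes orth: "\<And>i. y i ** transpose (y i) = mat 1"
  shows "2 * dim (kernel_multipliers y I) + (CARD('d) + 1) * dim (span (\<Union>i\<in>I. range (\<lambda>z. z v* y i)))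
    \<le> (CARD('d) + 1) * (CARD('d) * card I)"
  using finite[of I]
proof (induction I rule: finite_induct)
  case empty
  have "kernel_multipliers y {} = {0}" by (auto simp: kernel_multipliers_def vec_eq_iff Sym_zero)
  then show ?case by simp
next
  case (insert i I)
  define W where "W = (\<lambda>I. span (\<Union>i\<in>I. range (\<lambda>z. z v* y i)))"
  define V where "V = (\<lambda>i. range (\<lambda>z. z v* y i))"
  \<comment> \<open>The block \<open>L $ i\<close> of a multiplier has its range in \<open>U\<close>: apply the relation defining the
    multipliers to \<open>w = z v* y i\<close>, for which \<open>y i *v w = z\<close>.\<close>
  define U where "U = {z. z v* y i \<in> W I}"
  have lin: "linear (\<lambda>z. z v* y i)" for i
    by (rule linearI) (simp_all add: vector_matrix_left_distrib scaleR_vector_matrix_assoc)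
  have right_inv: "y i *v (z v* y i) = z" for i z
    using orth[of i] by (metis matrix_vector_mul_assoc matrix_vector_mul_lid transpose_matrix_vector)
  have inj: "inj (\<lambda>z. z v* y i)" for i
    by (metis injI right_inv)
  have subV: "subspace (V i)" for i
    unfolding V_def using linear_subspace_image[OF lin subspace_UNIV] .
  have subW: "subspace (W I)" for I by (simp add: W_def)
  have subU: "subspace U"
    unfolding U_def using linear_subspace_vimage[OF lin subW] by (simp add: vimage_def)
  have VW: "V j \<subseteq> W J" if "j \<in> J" for j J
    using that by (auto simp: V_def W_def intro!: span_base)
  have dimV: "dim (V i) = CARD('d)"
    unfolding V_def using dim_image_eq[OF lin, of i UNIV] inj by simp
  have "(\<lambda>z. z v* y i) ` U = V i \<inter> W I" by (auto simp: U_def V_def)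
  then have dimU: "dim U = dim (V i \<inter> W I)"
    using dim_image_eq[OF lin, of i U] inj_on_subset[OF inj] by (metis subset_UNIV)
  \<comment> \<open>The dimension formula for a sum of subspaces, with the intersection
    \<open>V i \<inter> W I\<close> identified with \<open>U\<close> through the injective map
    \<open>z v* y i\<close>.\<close>
  have "W (insert i I) = {a + b |a b. a \<in> V i \<and> b \<in> W I}"
    using subV[of i] by (simp add: W_def span_Un V_def span_eq_iff[THEN iffD2])
  then have dimW: "dim (W (insert i I)) + dim U = CARD('d) + dim (W I)"
    using dim_sums_Int[OF subV[of i] subW[of I]] dimU dimV by simp
  have "linear (\<lambda>L :: real ^ 'd ^ 'd ^ 'm. L $ i)" by (simp add: linear_iff)
  note dim_le_dim_kernel_image[OF this subspace_kernel_multipliers[of y "insert i I"]]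
  moreover have "{L \<in> kernel_multipliers y (insert i I). L $ i = 0} = kernel_multipliers y I"
    using insert.hyps by (auto simp: kernel_multipliers_def)
  ultimately have kernel_le: "dim (kernel_multipliers y (insert i I))
      \<le> dim (kernel_multipliers y I) + dim ((\<lambda>L. L $ i) ` kernel_multipliers y (insert i I))" by simp
  have "(\<lambda>L. L $ i) ` kernel_multipliers y (insert i I) \<subseteq> {M \<in> Sym. \<forall>z. M *v z \<in> U}"
  proof safe
    fix L z assume L: "L \<in> kernel_multipliers y (insert i I)"
    then show "L $ i \<in> Sym" by (simp add: kernel_multipliers_def)
    define w where "w = z v* y i"
    define t where "t = (\<lambda>j. (L $ j *v (y j *v w)) v* y j)"
    have t: "t j = (transpose (y j) ** L $ j ** y j) *v w" for j
      by (simp add: t_def matrix_vector_mul_assoc[symmetric])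
    have "(\<Sum>j\<in>UNIV. t j) = 0"
      using L unfolding t sum_matrix_vector_mult[symmetric] by (simp add: kernel_multipliers_def)
    then have "t i = - (\<Sum>j\<in>UNIV - {i}. t j)"
      by (simp add: sum.remove[of UNIV i] eq_neg_iff_add_eq_0)
    \<comment> \<open>Each other term lies in the row space of an old slice or vanishes because
      \<open>L\<close> is supported on \<open>insert i I\<close>; thus \<open>t i\<close> is forced
      into \<open>W I\<close>.\<close>
    moreover have "t j \<in> W I" if "j \<in> UNIV - {i}" for j
    proof (cases "j \<in> I")
      case True
      then show ?thesis using VW[OF True] by (auto simp: t_def V_def)
    next
      case False
      then have "L $ j = 0" using L that by (auto simp: kernel_multipliers_def)
      then show ?thesis using subspace_0[OF subW] by (simp add: t_def)
    qed
    ultimately have "t i \<in> W I" using subW by (metis subspace_neg subspace_sum)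
    then show "L $ i *v z \<in> U" by (simp add: U_def t_def w_def right_inv)
  qed
  then have "2 * dim ((\<lambda>L. L $ i) ` kernel_multipliers y (insert i I)) \<le> dim U * (dim U + 1)"
    using dim_Sym_range_subset[OF subU] dim_subset by (metis (no_types, lifting) le_trans mult_le_mono2)
  \<comment> \<open>The quadratic bound is made linear in \<open>dim U\<close>, with the same weight
    \<open>d + 1\<close> as the span, so that the two contributions of \<open>dim U\<close> cancel
    below.\<close>
  also have "dim U * (dim U + 1) \<le> dim U * (CARD('d) + 1)"
    using dim_subset_UNIV[of U] by (intro mult_le_mono2) simp
  finally have "2 * dim ((\<lambda>L. L $ i) ` kernel_multipliers y (insert i I)) \<le> (CARD('d) + 1) * dim U"
    by (simp add: mult.commute)
  then have "2 * dim (kernel_multipliers y (insert i I))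
      \<le> 2 * dim (kernel_multipliers y I) + (CARD('d) + 1) * dim U"
    using kernel_le by linarith
  then have "2 * dim (kernel_multipliers y (insert i I)) + (CARD('d) + 1) * dim (W (insert i I))
      \<le> 2 * dim (kernel_multipliers y I) + (CARD('d) + 1) * (dim (W (insert i I)) + dim U)"
    by (simp add: algebra_simps)
  also have "\<dots> = 2 * dim (kernel_multipliers y I) + (CARD('d) + 1) * dim (W I)
      + (CARD('d) + 1) * CARD('d)"
    unfolding dimW by (simp add: algebra_simps)
  also have "\<dots> \<le> (CARD('d) + 1) * (CARD('d) * card (insert i I))"
    using insert by (simp add: W_def algebra_simps)
  finally show ?case by (simp add: W_def)
qed

section \<open>Adjoint identities and rank-one tangent directions\<close>

lemma inner_matrix_mult_left: "(A ** B) \<bullet> C = B \<bullet> (transpose A ** C)"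
  for A :: "real ^ 'n ^ 'm"
  by (simp add: inner_matrix_eq_trace matrix_transpose_mul matrix_mul_assoc)

lemma inner_matrix_mult_right: "(A ** B) \<bullet> C = A \<bullet> (C ** transpose B)"
  for A :: "real ^ 'n ^ 'm"
  using trace_mul_sym[of "transpose B" "transpose A ** C"]
  by (simp add: inner_matrix_eq_trace matrix_transpose_mul matrix_mul_assoc)

lemma inner_transpose: "transpose A \<bullet> transpose B = A \<bullet> B"
  for A :: "real ^ 'n ^ 'm"
  using trace_mul_sym[of A "transpose B"] inner_commute[of A B]
  by (simp add: inner_matrix_eq_trace)

lemma Sym_inner_transpose: "M \<in> Sym \<Longrightarrow> M \<bullet> transpose B = M \<bullet> B"
  using inner_transpose[of M "transpose B"] by (simp add: Sym_def)

text \<open>Without a common kernel vector of the slices, the equations for \<open>A\<close> are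
  solved by the Fredholm alternative: the right-hand side must be orthogonal to the symmetric
  families in the kernel of the adjoint, which form
  \<open>kernel_multipliers y UNIV\<close>.\<close>

lemma exists_rank_one_tangent_correction:
  fixes y :: "'m::finite \<Rightarrow> real ^ 'p ^ 'd::finite" and x :: "'m \<Rightarrow> real ^ 'd"
  assumes orth: "\<And>i. y i ** transpose (y i) = mat 1"
    and p: "(CARD('d) + 1) * (CARD('d) * CARD('m)) < (CARD('d) + 3) * CARD('p)"
  obtains v A where "v \<noteq> 0"
    "\<And>i. (outer (x i) v + y i ** A) ** transpose (y i)
        + y i ** transpose (outer (x i) v + y i ** A) = 0"
proof -
  define W where "W = span (\<Union>i. range (\<lambda>z. z v* y i))"
  show thesis
  proof (cases "W = UNIV")
    case False
    then have "dim W < DIM(real ^ 'p)"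
      unfolding W_def by (metis dim_eq_full dim_span dim_subset_UNIV order_le_less span_span)
    then obtain v where v: "v \<noteq> 0" "\<And>w. w \<in> span W \<Longrightarrow> orthogonal v w"
      using orthogonal_to_subspace_exists by blast
    \<comment> \<open>The vector \<open>(y i *v v) v* y i\<close> lies in \<open>W\<close>, and its
      inner product with \<open>v\<close> is the squared norm of \<open>y i *v v\<close>.\<close>
    have "y i *v v = 0" for i
    proof -
      have "(y i *v v) v* y i \<in> span W" by (auto simp: W_def intro!: span_base)
      then have "((y i *v v) v* y i) \<bullet> v = 0"
        using v(2)[of "(y i *v v) v* y i"] by (simp add: orthogonal_def inner_commute)
      then show ?thesis by (simp add: dot_lmul_matrix)
    qed
    then show ?thesis
      using that[of v 0] v(1)
      by (simp add: outer_mult_transpose transpose_outer matrix_mult_outer)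
  next
    case True
    define N where "N = kernel_multipliers y UNIV"
    have "2 * dim N + (CARD('d) + 1) * CARD('p) \<le> (CARD('d) + 1) * (CARD('d) * CARD('m))"
      using dim_kernel_multipliers[of y UNIV, OF orth] unfolding W_def[symmetric] True by (simp add: N_def)
    \<comment> \<open>Here 2 \<open>dim N\<close> is at most (d+1)(n-p), and (d+1)(n-p) < 2p is a
      rearrangement of the hypothesis \<open>p\<close>.\<close>
    then have dimN: "dim N < CARD('p)" using p by (simp add: algebra_simps)
    \<comment> \<open>This is the map from a block-diagonal multiplier to \<open>Y\<close>-transpose
      times multiplier times \<open>x\<close>. Its image of \<open>N\<close> has dimension below p,
      which leaves room for \<open>v\<close>.\<close>
    define w where "w = (\<lambda>L :: real ^ 'd ^ 'd ^ 'm. \<Sum>i\<in>UNIV. (L $ i *v x i) v* y i)"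
    have "linear w"
      unfolding w_def
      by (rule linearI) (simp_all add: matrix_vector_mult_add_rdistrib vector_matrix_left_distrib
          sum.distrib scaleR_matrix_vector_assoc[symmetric] scaleR_vector_matrix_assoc scaleR_sum_right)
    then have "dim (w ` N) < DIM(real ^ 'p)"
      using dim_image_le[of w N] dimN by simp
    then obtain v where v: "v \<noteq> 0" "\<And>u. u \<in> span (w ` N) \<Longrightarrow> orthogonal v u"
      using orthogonal_to_subspace_exists by blast
    \<comment> \<open>\<open>D\<close> and \<open>F A\<close> are the contributions of
      \<open>outer (x i) v\<close> and \<open>y i ** A\<close> to the tangency equations.\<close>
    define D where "D = (\<chi> i. outer (x i) (y i *v v) + outer (y i *v v) (x i))"
    define F where "F = (\<lambda>A :: real ^ 'p ^ 'p. \<chi> i. y i ** (A + transpose A) ** transpose (y i))"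
    have linF: "linear F"
      unfolding F_def
      by (rule linearI) (simp_all add: vec_eq_iff[where 'b = 'm] transpose_add matrix_add_ldistrib
          matrix_mult_add_rdistrib matrix_mult_scaleR_left matrix_mult_scaleR_right transpose_scalar
          scaleR_add_right)
    \<comment> \<open>The component \<open>z\<close> of \<open>D\<close> orthogonal to the range of \<open>F\<close> is itself a kernel multiplier, hence
      orthogonal to \<open>D\<close> by the choice of \<open>v\<close>, hence zero.\<close>
    obtain a z where az: "a \<in> span (range F)" "\<And>u. u \<in> span (range F) \<Longrightarrow> orthogonal z u"
        "D = a + z"
      using orthogonal_subspace_decomp_exists by blast
    have "subspace (range F)" using linear_subspace_image[OF linF subspace_UNIV] .
    then obtain A where A: "a = F A" using az(1) by (auto simp: span_eq_iff[THEN iffD2])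
    have symD: "D $ i \<in> Sym" for i
      by (simp add: D_def Sym_def transpose_def outer_def vec_eq_iff)
    have symF: "F A $ i \<in> Sym" for A i
      by (simp add: F_def Sym_def matrix_transpose_mul transpose_add add.commute matrix_mul_assoc)
    have symz: "z $ i \<in> Sym" for i
    proof -
      have "z $ i = D $ i - F A $ i" using az(3) A by simp
      then show ?thesis using subspace_diff[OF subspace_Sym symD symF] by metis
    qed
    have "z \<in> N"
    proof -
      \<comment> \<open>The adjoint of \<open>F\<close> turns the pairing of \<open>z\<close> with
        \<open>F A\<close> into that of \<open>Q\<close> with \<open>A + transpose A\<close>.
        Testing with \<open>A = Q\<close> gives twice the squared norm of \<open>Q\<close>.\<close>
      define Q where "Q = (\<Sum>i\<in>UNIV. transpose (y i) ** z $ i ** y i)"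
      have Qsym: "Q \<in> Sym"
        unfolding Q_def using symz
        by (intro subspace_sum[OF subspace_Sym]) (simp add: Sym_def matrix_transpose_mul matrix_mul_assoc)
      have "0 = z \<bullet> F Q" using az(2)[of "F Q"] by (auto simp: orthogonal_def intro: span_base)
      also have "\<dots> = (\<Sum>i\<in>UNIV. z $ i \<bullet> (y i ** (Q + transpose Q) ** transpose (y i)))"
        by (simp add: inner_vec_def[where 'b = 'm] F_def)
      also have "\<dots> = (\<Sum>i\<in>UNIV. (transpose (y i) ** z $ i ** y i) \<bullet> (Q + transpose Q))"
        by (intro sum.cong refl)
          (simp only: inner_matrix_mult_right[of "transpose _ ** _" "y _"]
            inner_matrix_mult_left[of "transpose (y _)" "z $ _"] transpose_transpose matrix_mul_assoc)
      also have "\<dots> = Q \<bullet> (Q + transpose Q)" by (simp add: Q_def inner_sum_left)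
      also have "\<dots> = 2 * (Q \<bullet> Q)" using Qsym by (subst inner_add_right) (simp add: Sym_def)
      finally have "Q = 0" by simp
      then show ?thesis using symz by (simp add: N_def kernel_multipliers_def Q_def)
    qed
    then have "w z \<bullet> v = 0"
      using v(2)[of "w z"] by (auto simp: orthogonal_def inner_commute intro: span_base)
    \<comment> \<open>Since each \<open>z $ i\<close> is symmetric, the two outer products in
      \<open>D\<close> pair equally with it.\<close>
    moreover have "z \<bullet> D = 2 * (w z \<bullet> v)"
    proof -
      have "z $ i \<bullet> D $ i = 2 * (((z $ i *v x i) v* y i) \<bullet> v)" for i
        using Sym_inner_swap[OF symz[of i], of "x i" "y i *v v"]
          dot_lmul_matrix[of "z $ i *v x i" "y i" v] inner_commute[of "y i *v v" "z $ i *v x i"]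
        by (simp add: D_def inner_add_right inner_outer)
      then show ?thesis
        by (simp add: inner_vec_def[where 'b = 'm] w_def inner_sum_left sum_distrib_left)
    qed
    moreover have "z \<bullet> a = 0" using az by (simp add: orthogonal_def)
    ultimately have "z = 0" using az(3) by (simp add: inner_add_right)
    then have D: "D = F A" using az(3) A by simp
    \<comment> \<open>The correction is \<open>- A\<close>, because \<open>D = F A\<close> has to be
      cancelled.\<close>
    have "(outer (x i) v + y i ** - A) ** transpose (y i)
        + y i ** transpose (outer (x i) v + y i ** - A) = 0" for i
    proof -
      have "(outer (x i) v + y i ** - A) ** transpose (y i)
          + y i ** transpose (outer (x i) v + y i ** - A) = D $ i + F (- A) $ i"
        by (simp add: D_def F_def outer_mult_transpose transpose_outer matrix_mult_outer transpose_add
            matrix_add_ldistrib matrix_mult_add_rdistrib matrix_transpose_mul matrix_mul_assoc)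
      then show ?thesis using D linear_neg[OF linF] by simp
    qed
    then show ?thesis using that[OF v(1)] by blast
  qed
qed

section \<open>Slices, blocks and positivity from tangent directions\<close>

lemma slice_add: "slice (A + B) i = slice A i + slice B i"
  by (simp add: slice_def vec_eq_iff)

lemma slice_mult: "slice (Y ** A) i = slice Y i ** A"
  by (simp add: slice_def matrix_matrix_mult_def vec_eq_iff)

lemma slice_outer: "slice (outer x v) i = outer (\<chi> a. x $ (i, a)) v"
  by (simp add: slice_def outer_def vec_eq_iff)

lemma block_mult_transpose: "block (A ** transpose B) i j = slice A i ** transpose (slice B j)"
  by (simp add: block_def slice_def transpose_def matrix_matrix_mult_def vec_eq_iff)

lemma block_add: "block (A + B) i j = block A i j + block B i j"
  by (simp add: block_def vec_eq_iff)

lemma block_diff: "block (A - B) i j = block A i j - block B i j"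
  by (simp add: block_def vec_eq_iff)

lemma symblockdiag_eq_0: "(\<And>i. block M i i = 0) \<Longrightarrow> symblockdiag M = 0"
  by (simp add: symblockdiag_def vec_eq_iff transpose_def)

lemma symblockdiag_scaleR: "symblockdiag (c *\<^sub>R M) = c *\<^sub>R symblockdiag M"
  by (simp add: symblockdiag_def vec_eq_iff transpose_def block_def algebra_simps)

lemma symblockdiag_in_Sym: "symblockdiag M \<in> Sym"
  by (simp add: symblockdiag_def Sym_def vec_eq_iff transpose_def add.commute)

lemma block_diagonal_minus_symblockdiag: "block_diagonal (- symblockdiag M)"
  by (simp add: symblockdiag_def block_diagonal_def block_def vec_eq_iff)

text \<open>The supports of the two matrices are disjoint. This applies to differences of feasible
  points, whose diagonal blocks agree.\<close>

lemma inner_symblockdiag_eq_0: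
  assumes "\<And>i. block M i i = 0"
  shows "symblockdiag N \<bullet> M = 0"
proof -
  have "symblockdiag N $ (i, a) $ (j, b) * M $ (i, a) $ (j, b) = 0" for i j a b
    using assms[of i] by (cases "i = j") (auto simp: symblockdiag_def block_def vec_eq_iff)
  then show ?thesis by (simp add: inner_vec_def split_paired_all sum.neutral)
qed

lemma tangent_spaceI:
  assumes "\<And>i. slice Z i ** transpose (slice Y i) + slice Y i ** transpose (slice Z i) = 0"
  shows "Z \<in> tangent_space Y"
  using assms by (simp add: tangent_space_def symblockdiag_eq_0 block_add block_mult_transpose)

lemma psd_of_nonneg_on_tangent_space:
  fixes Y :: "real ^ 'p ^ ('m::finite \<times> 'd::finite)"
  assumes Y: "Y \<in> St" and S: "S \<in> Sym" and SY: "S ** Y = 0"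
    and p: "(CARD('d) + 1) * (CARD('d) * CARD('m)) < (CARD('d) + 3) * CARD('p)"
    and nonneg: "\<And>Z. Z \<in> tangent_space Y \<Longrightarrow> 0 \<le> Z \<bullet> (S ** Z)"
  shows "psd S"
  unfolding psd_def
proof (intro conjI allI)
  fix x :: "real ^ ('m \<times> 'd)"
  have "slice Y i ** transpose (slice Y i) = mat 1" for i
    using Y by (simp add: St_def)
  from exists_rank_one_tangent_correction[of "slice Y" "\<lambda>i. \<chi> a. x $ (i, a)", OF this p]
  obtain v A where v: "v \<noteq> 0" and A: "\<And>i.
      (outer (\<chi> a. x $ (i, a)) v + slice Y i ** A) ** transpose (slice Y i)
        + slice Y i ** transpose (outer (\<chi> a. x $ (i, a)) v + slice Y i ** A) = 0"
    by metis
  define Z where "Z = outer x v + Y ** A"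
  have "Z \<in> tangent_space Y"
    by (rule tangent_spaceI) (simp add: Z_def slice_add slice_outer slice_mult A)
  then have "0 \<le> Z \<bullet> (S ** Z)" by (rule nonneg)
  also have "S ** Z = S ** outer x v"
    using SY by (simp add: Z_def matrix_add_ldistrib matrix_mul_assoc)
  also have "Z \<bullet> (S ** outer x v) = outer x v \<bullet> (S ** outer x v)"
  proof -
    \<comment> \<open>Symmetry converts \<open>S ** Y = 0\<close> into its transposed form, which
      removes \<open>Y ** A\<close> from the left factor as well.\<close>
    have "transpose Y ** S = transpose (S ** Y)"
      using S by (simp add: matrix_transpose_mul Sym_def)
    then have "(Y ** A) \<bullet> (S ** outer x v) = 0"
      using SY by (simp add: inner_matrix_mult_left matrix_mul_assoc transpose_def[of 0] zero_vec_def[symmetric])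
    then show ?thesis by (simp add: Z_def inner_add_left)
  qed
  also have "\<dots> = (x \<bullet> (S *v x)) * (v \<bullet> v)"
    by (simp add: matrix_mult_outer inner_outer outer_mult_vec inner_commute)
  finally show "0 \<le> x \<bullet> (S *v x)" 
    using v by (metis inner_gt_zero_iff zero_le_mult_iff not_le)
qed (rule S)

section \<open>Derivatives of concave functions within the symmetric matrices\<close>

text \<open>The whole line stays in \<open>Sym\<close>, so the derivative within \<open>Sym\<close>
  yields an ordinary one in one real variable.\<close>

lemma has_derivative_along_line_in_Sym:
  fixes f :: "real ^ 'n ^ 'n \<Rightarrow> 'b::real_normed_vector"
  assumes "(f has_derivative K) (at X within Sym)" "X \<in> Sym" "H \<in> Sym"
  shows "((\<lambda>t. f (X + t *\<^sub>R H)) has_derivative (\<lambda>t. t *\<^sub>R K H)) (at 0)"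
proof -
  have line: "((\<lambda>t::real. X + t *\<^sub>R H) has_derivative (\<lambda>t. t *\<^sub>R H)) (at 0)"
    by (auto intro!: derivative_eq_intros)
  have "range (\<lambda>t::real. X + t *\<^sub>R H) \<subseteq> Sym"
    using subspace_Sym assms(2,3) by (auto intro: subspace_add subspace_scale)
  then have "(f has_derivative K) (at (X + 0 *\<^sub>R H) within range (\<lambda>t::real. X + t *\<^sub>R H))"
    using has_derivative_subset[OF assms(1)] by simp
  from has_derivative_in_compose[OF line this] show ?thesis
    by (simp add: linear_scale[OF has_derivative_linear[OF assms(1)]])
qed

text \<open>The restriction of \<open>- f\<close> to the line through \<open>X\<close> and
  \<open>Z\<close> is convex; its tangent at parameter 0 is compared with its value at 1.\<close>

lemma concave_on_Sym_below_tangent: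
  assumes f: "concave_on Sym f" "f differentiable (at X within Sym)"
    and X: "X \<in> Sym" and Z: "Z \<in> Sym"
  shows "f Z \<le> f X + sym_grad f X \<bullet> (Z - X)"
proof -
  define \<phi> where "\<phi> t = - f (X + t *\<^sub>R (Z - X))" for t
  have H: "Z - X \<in> Sym" using X Z by (simp add: subspace_diff subspace_Sym)
  have mem: "X + t *\<^sub>R (Z - X) \<in> Sym" for t
    using X H by (simp add: subspace_add subspace_scale subspace_Sym)
  have "convex_on UNIV \<phi>"
  proof (rule convex_onI)
    fix t x y :: real assume t: "0 < t" "t < 1"
    have "X + ((1 - t) *\<^sub>R x + t *\<^sub>R y) *\<^sub>R (Z - X)
        = (1 - t) *\<^sub>R (X + x *\<^sub>R (Z - X)) + t *\<^sub>R (X + y *\<^sub>R (Z - X))"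
      by (simp add: algebra_simps)
    then show "\<phi> ((1 - t) *\<^sub>R x + t *\<^sub>R y) \<le> (1 - t) * \<phi> x + t * \<phi> y"
      using convex_onD[OF f(1)[unfolded concave_on_def], of t "X + x *\<^sub>R (Z - X)" "X + y *\<^sub>R (Z - X)"]
        t mem by (simp add: \<phi>_def)
  qed simp
  moreover have "(\<phi> has_field_derivative - (sym_grad f X \<bullet> (Z - X))) (at 0)"
  proof -
    have "((\<lambda>t. f (X + t *\<^sub>R (Z - X))) has_field_derivative sym_grad f X \<bullet> (Z - X)) (at 0)"
      using has_derivative_along_line_in_Sym[OF sym_grad_has_derivative(2)[OF X f(2)] X H]
      by (simp add: has_field_derivative_def mult_commute_abs)
    then show ?thesis unfolding \<phi>_def by (rule DERIV_minus)
  qed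
  ultimately have "\<phi> 1 - \<phi> 0 \<ge> - (sym_grad f X \<bullet> (Z - X)) * (1 - 0)"
    by (intro convex_on_imp_above_tangent[of UNIV]) auto
  then show ?thesis by (simp add: \<phi>_def)
qed

lemma sym_hess_has_derivative:
  assumes "sym_grad f differentiable (at X within Sym)"
  shows "(sym_grad f has_derivative sym_hess f X) (at X within Sym)"
  using assms frechet_derivative_works unfolding sym_hess_def by blast

text \<open>Differentiating the symmetry of the gradient gives that of the Hessian value, by
  uniqueness of derivatives in symmetric directions.\<close>

lemma sym_hess_in_Sym:
  assumes f: "C2_on_Sym f" and X: "X \<in> Sym" and H: "H \<in> Sym"
  shows "sym_hess f X H \<in> Sym"
proof -
  have der: "(sym_grad f has_derivative sym_hess f X) (at X within Sym)"
    using f X by (intro sym_hess_has_derivative) (simp add: C2_on_Sym_def differentiable_on_def)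
  have "bounded_linear (transpose :: real ^ 'a ^ 'a \<Rightarrow> _)"
    unfolding linear_conv_bounded_linear[symmetric]
    by (intro linearI) (simp_all add: transpose_add transpose_scalar)
  from bounded_linear.has_derivative[OF this der]
  have "((\<lambda>X. transpose (sym_grad f X)) has_derivative (\<lambda>H. transpose (sym_hess f X H)))
      (at X within Sym)" .
  moreover have "transpose (sym_grad f Z) = sym_grad f Z" if "Z \<in> Sym" for Z
    using sym_grad_has_derivative(1)[OF that] f that
    by (simp add: C2_on_Sym_def differentiable_on_def Sym_def)
  ultimately have "(sym_grad f has_derivative (\<lambda>H. transpose (sym_hess f X H))) (at X within Sym)"
    using X by (rule_tac has_derivative_transform) auto
  from has_derivative_within_Sym_unique[OF this der X H]
  show ?thesis by (simp add: Sym_def)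
qed

text \<open>Adding the tangent inequalities at \<open>X\<close> and at \<open>Z\<close> shows that
  the slope \<open>\<psi>\<close> cannot increase along \<open>H\<close>, whereas a positive value
  of the quadratic form would make it increase just right of 0.\<close>

lemma concave_on_Sym_hess_nonpos:
  assumes f: "C2_on_Sym f" "concave_on Sym f" and X: "X \<in> Sym" and H: "H \<in> Sym"
  shows "H \<bullet> sym_hess f X H \<le> 0"
proof (rule ccontr)
  assume neg: "\<not> H \<bullet> sym_hess f X H \<le> 0"
  have diff: "f differentiable (at Z within Sym)" if "Z \<in> Sym" for Z
    using f(1) that by (simp add: C2_on_Sym_def differentiable_on_def)
  have der: "(sym_grad f has_derivative sym_hess f X) (at X within Sym)"
    using f X by (intro sym_hess_has_derivative) (simp add: C2_on_Sym_def differentiable_on_def)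
  define \<psi> where "\<psi> t = H \<bullet> sym_grad f (X + t *\<^sub>R H)" for t
  have "(\<psi> has_field_derivative H \<bullet> sym_hess f X H) (at 0)"
    using bounded_linear.has_derivative[OF bounded_linear_inner_right
        has_derivative_along_line_in_Sym[OF der X H], of H]
    by (simp add: \<psi>_def[abs_def] has_field_derivative_def mult_commute_abs)
  from DERIV_pos_inc_right[OF this] neg obtain d where
    d: "d > 0" "\<And>h. 0 < h \<Longrightarrow> h < d \<Longrightarrow> \<psi> 0 < \<psi> h" by auto
  define t where "t = d / 2"
  define Z where "Z = X + t *\<^sub>R H"
  have t: "0 < t" "t < d" using d(1) by (auto simp: t_def)
  have Z: "Z \<in> Sym" using X H by (simp add: Z_def subspace_add subspace_scale subspace_Sym)
  have "f Z \<le> f X + sym_grad f X \<bullet> (Z - X)" "f X \<le> f Z + sym_grad f Z \<bullet> (X - Z)"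
    using concave_on_Sym_below_tangent[OF f(2)] diff X Z by auto
  then have "t * (\<psi> t - \<psi> 0) \<le> 0"
    by (simp add: Z_def \<psi>_def algebra_simps inner_commute)
  with t d(2)[OF t] show False by (simp add: mult_le_0_iff)
qed

section \<open>Feasibility, linear costs and the optimality certificate\<close>

text \<open>The inner product is the sum of the quadratic form of \<open>S\<close> over the columns
  of \<open>Z\<close>.\<close>

lemma psd_inner_mult_transpose:
  assumes "psd S"
  shows "0 \<le> S \<bullet> (Z ** transpose Z)"
proof -
  have "S \<bullet> (Z ** transpose Z) = (S ** Z) \<bullet> Z"
    by (simp add: inner_matrix_mult_right)
  also have "\<dots> = (\<Sum>r\<in>UNIV. \<Sum>k\<in>UNIV. (S *v column k Z) $ r * column k Z $ r)"
    by (simp add: inner_vec_def matrix_matrix_mult_def matrix_vector_mult_def column_def)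
  also have "\<dots> = (\<Sum>k\<in>UNIV. column k Z \<bullet> (S *v column k Z))"
    by (subst sum.swap) (simp add: inner_vec_def mult.commute)
  also have "\<dots> \<ge> 0" using assms by (intro sum_nonneg) (simp add: psd_def)
  finally show ?thesis .
qed

lemma mult_transpose_in_Sym: "Y ** transpose Y \<in> Sym"
  for Y :: "real ^ 'p ^ 'n"
  by (simp add: Sym_def matrix_transpose_mul)

lemma mult_transpose_feasible:
  assumes "Y \<in> St"
  shows "Y ** transpose Y \<in> feasible_set"
proof -
  have "v \<bullet> ((Y ** transpose Y) *v v) = (v v* Y) \<bullet> (v v* Y)" for v
    by (simp add: matrix_vector_mul_assoc[symmetric] dot_lmul_matrix)
  then show ?thesis
    using assms by (simp add: feasible_set_def psd_def mult_transpose_in_Sym block_mult_transpose St_def)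
qed

text \<open>Along the line \<open>X + t *\<^sub>R H\<close> the function is affine with slope
  \<open>f H\<close>, whatever the base point.\<close>

lemma linear_on_Sym_grad:
  assumes f: "linear_on_Sym f" "f differentiable (at X within Sym)" and X: "X \<in> Sym" and H: "H \<in> Sym"
  shows "sym_grad f X \<bullet> H = f H"
proof -
  have "f (X + t *\<^sub>R H) = f X + t * f H" for t
    using f(1) X H subspace_scale[OF subspace_Sym H] by (simp add: linear_on_Sym_def)
  then have "((\<lambda>t. f X + t * f H) has_derivative (\<lambda>t. t *\<^sub>R (sym_grad f X \<bullet> H))) (at 0)"
    using has_derivative_along_line_in_Sym[OF sym_grad_has_derivative(2)[OF X f(2)] X H] by simp
  moreover have "((\<lambda>t. f X + t * f H) has_derivative (\<lambda>t. t * f H)) (at 0)"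
    by (auto intro!: derivative_eq_intros)
  ultimately have "(\<lambda>t. t *\<^sub>R (sym_grad f X \<bullet> H)) = (\<lambda>t. t * f H)"
    by (rule has_derivative_unique)
  from fun_cong[OF this, of 1] show ?thesis by simp
qed

text \<open>The Hessian term of the second-order condition equals \<open>H \<bullet> K\<close>,
  which concavity makes nonpositive; the remaining term must then be nonnegative on tangent
  vectors.\<close>

lemma second_order_critical_point_psd:
  fixes f :: "('m::finite, 'd::finite) bmat \<Rightarrow> real" and Y :: "real ^ 'p ^ ('m \<times> 'd)"
  assumes f: "C2_on_Sym f" "concave_on Sym f"
    and p: "(CARD('d) + 1) * (CARD('d) * CARD('m)) < (CARD('d) + 3) * CARD('p)"
    and Y: "second_order_critical_point f Y"
  defines "X \<equiv> Y ** transpose Y"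
  defines "S \<equiv> sym_grad f X - symblockdiag (sym_grad f X ** X)"
  shows "S ** Y = 0" and "psd S"
proof -
  have X: "X \<in> Sym" unfolding X_def by (rule mult_transpose_in_Sym)
  have YSt: "Y \<in> St" and SY: "S ** Y = 0"
    using Y by (simp_all add: second_order_critical_point_def critical_point_def Let_def X_def S_def)
  show "S ** Y = 0" by (rule SY)
  have G: "sym_grad f X \<in> Sym"
    using sym_grad_has_derivative(1)[OF X] f(1) X by (simp add: C2_on_Sym_def differentiable_on_def)
  have S: "S \<in> Sym"
    unfolding S_def by (intro subspace_diff[OF subspace_Sym] G symblockdiag_in_Sym)
  show "psd S"
  proof (rule psd_of_nonneg_on_tangent_space[OF YSt S SY p])
    fix Z assume Z: "Z \<in> tangent_space Y"
    define H where "H = Z ** transpose Y + Y ** transpose Z"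
    define K where "K = sym_hess f X H"
    have H: "H \<in> Sym" by (simp add: H_def Sym_def transpose_add matrix_transpose_mul add.commute)
    have K: "K \<in> Sym" unfolding K_def by (rule sym_hess_in_Sym[OF f(1) X H])
    have "cost_hess f Y Z - symblockdiag (cost_grad f Y ** transpose Y) ** Z
        = 2 *\<^sub>R (K ** Y) + 2 *\<^sub>R (S ** Z)"
      by (simp add: cost_hess_def cost_grad_def matrix_mult_scaleR_left symblockdiag_scaleR S_def
          X_def K_def H_def matrix_mult_diff_rdistrib scaleR_add_right scaleR_diff_right
          matrix_mul_assoc)
    moreover have "0 \<le> Z \<bullet> (cost_hess f Y Z - symblockdiag (cost_grad f Y ** transpose Y) ** Z)"
      using Y Z by (simp add: second_order_critical_point_def)
    ultimately have "0 \<le> 2 * (Z \<bullet> (K ** Y)) + 2 * (Z \<bullet> (S ** Z))"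
      by (simp add: inner_add_right)
    \<comment> \<open>As \<open>K\<close> is symmetric, it pairs equally with the two mutually
      transposed summands of \<open>H\<close>.\<close>
    moreover have "2 * (Z \<bullet> (K ** Y)) = H \<bullet> K"
    proof -
      have "Z \<bullet> (K ** Y) = K \<bullet> (Z ** transpose Y)"
        using inner_matrix_mult_right[of K Y Z] by (simp add: inner_commute)
      moreover have "K \<bullet> (Y ** transpose Z) = K \<bullet> (Z ** transpose Y)"
        using Sym_inner_transpose[OF K, of "Z ** transpose Y"] by (simp add: matrix_transpose_mul)
      ultimately show ?thesis by (simp add: H_def inner_add_right inner_commute[of _ K])
    qed
    moreover have "H \<bullet> K \<le> 0" unfolding K_def by (rule concave_on_Sym_hess_nonpos[OF f X H])
    ultimately show "0 \<le> Z \<bullet> (S ** Z)" by simp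
  qed
qed

theorem corollary3p16:
  fixes f :: "('m::finite, 'd::finite) bmat \<Rightarrow> real"
  assumes "CARD('d) \<le> CARD('p::finite)"
    and "CARD('p) \<le> CARD('m) * CARD('d)"
    and "C2_on_Sym f"
    and "concave_on Sym f"
    and "real CARD('p) > (real CARD('d) + 1) / (real CARD('d) + 3) * real (CARD('m) * CARD('d))"
  shows "(\<forall>Y :: real ^ 'p ^ ('m \<times> 'd).
            second_order_critical_point f Y \<longrightarrow> KKT_point f (Y ** transpose Y)) \<and>
         (linear_on_Sym f \<longrightarrow>
            (\<forall>Y :: real ^ 'p ^ ('m \<times> 'd).
               second_order_critical_point f Y \<longrightarrow> global_optimizer_RP f Y))"
proof -
  \<comment> \<open>The denominator is cleared so that the bound can be compared with dimensions as
    natural numbers.\<close>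
  have "(real CARD('d) + 1) * real (CARD('m) * CARD('d)) < (real CARD('d) + 3) * real CARD('p)"
    using assms(5) by (simp add: divide_less_eq mult.commute)
  then have "real ((CARD('d) + 1) * (CARD('d) * CARD('m))) < real ((CARD('d) + 3) * CARD('p))"
    by (simp add: algebra_simps)
  then have p: "(CARD('d) + 1) * (CARD('d) * CARD('m)) < (CARD('d) + 3) * CARD('p)"
    by (simp only: of_nat_less_iff)
  have diff: "f differentiable (at X within Sym)" if "X \<in> Sym" for X
    using assms(3) that by (simp add: C2_on_Sym_def differentiable_on_def)
  show ?thesis
  proof (intro conjI allI impI)
    fix Y :: "real ^ 'p ^ ('m \<times> 'd)"
    assume Y: "second_order_critical_point f Y"
    then have YSt: "Y \<in> St" by (simp add: second_order_critical_point_def critical_point_def)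
    define X where "X = Y ** transpose Y"
    \<comment> \<open>The multiplier of the KKT conditions is \<open>- D\<close>.\<close>
    define D where "D = symblockdiag (sym_grad f X ** X)"
    define S where "S = sym_grad f X - D"
    have X: "X \<in> Sym" unfolding X_def by (rule mult_transpose_in_Sym)
    have SY: "S ** Y = 0" and psd: "psd S"
      using second_order_critical_point_psd[OF assms(3,4) p Y] by (simp_all add: S_def D_def X_def)
    have SX: "S ** X = 0" using SY by (simp add: X_def matrix_mul_assoc)
    show "KKT_point f (Y ** transpose Y)"
      unfolding KKT_point_def X_def[symmetric]
    proof (intro conjI exI)
      show "X \<in> feasible_set" unfolding X_def by (rule mult_transpose_feasible[OF YSt])
      show "S \<in> Sym" using psd by (simp add: psd_def)
      show "- D \<in> Sym" unfolding D_def by (intro subspace_neg[OF subspace_Sym] symblockdiag_in_Sym)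
      show "block_diagonal (- D)" unfolding D_def by (rule block_diagonal_minus_symblockdiag)
      show "S = sym_grad f X + - D" by (simp add: S_def)
    qed (rule SX psd)+
    assume lin: "linear_on_Sym f"
    show "global_optimizer_RP f Y"
      unfolding global_optimizer_RP_def cost_def
    proof (intro conjI ballI YSt)
      fix Z :: "real ^ 'p ^ ('m \<times> 'd)" assume Z: "Z \<in> St"
      \<comment> \<open>Splitting the gradient as \<open>S + D\<close>, the \<open>D\<close> part
        vanishes because both points have identity diagonal blocks, and \<open>S \<bullet> X\<close>
        vanishes by complementarity.\<close>
      have "f (Z ** transpose Z) - f X = sym_grad f X \<bullet> (Z ** transpose Z - X)"
        using linear_on_Sym_grad[OF lin diff[OF X] X] X mult_transpose_in_Sym[of Z]
        by (simp add: inner_diff_right)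
      also have "\<dots> = S \<bullet> (Z ** transpose Z) - S \<bullet> X + D \<bullet> (Z ** transpose Z - X)"
        by (simp add: S_def inner_diff_left inner_diff_right)
      also have "S \<bullet> X = 0"
        using inner_matrix_mult_right[of S Y Y] SY by (simp add: X_def)
      also have "D \<bullet> (Z ** transpose Z - X) = 0"
        unfolding D_def using YSt Z
        by (intro inner_symblockdiag_eq_0) (simp add: block_diff block_mult_transpose St_def X_def)
      finally show "f (Y ** transpose Y) \<le> f (Z ** transpose Z)"
        using psd_inner_mult_transpose[OF psd, of Z] by (simp add: X_def)
    qed
  qed
qed

end
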